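(* Assume the range inclusion $\operatorname{ran}C_{VU}\subseteq\operatorname{ran}C_V$. Then the operator $C_V^\dagger C_{VU}:\mathcal G\to\mathcal H$ is everywhere defined and bounded. Moreover, the affine operator $\gamma^{\mathsf A}_{U|V}\in\mathsf A(\mathcal H;\mathcal G)$ defined by $$\gamma^{\mathsf A}_{U|V}(v):=\mu_U+(C_V^\dagger C_{VU})^*(v-\mu_V)$$ minimizes $\mathcal E_{U|V}(\gamma):=\mathbb E\big[\|U-\gamma\circ V\|_{\mathcal G}^2\big]$ over $\gamma\in\mathsf A(\mathcal H;\mathcal G)$. In particular, $\mathbb E^{\mathsf A}[U|V]=\gamma^{\mathsf A}_{U|V}\circ V$ a.s.
   Context: Standing setup: - $(\Omega,\Sigma,\mathbb P)$ is a probability space and $\mathcal G,\mathcal H$ are separable real Hilbert spaces. - $U\in L^2(\mathbb P;\mathcal G)$ and $V\in L^2(\mathbb P;\mathcal H)$, with Bochner means $\mu_U,\mu_V$. - For $g\in\mathcal G$ and $h\in\mathcal H$, $g\otimes h:\mathcal H\to\mathcal G$ is given by $h'\mapsto\langle h,h'\rangle g$. - $C_{UV}=\mathbb E[(U-\mu_U)\otimes(V-\mu_V)]$, $C_{VU}=C_{UV}^*$ and $C_V=C_{VV}$. - For a bounded linear $A$, $A^\dagger$ denotes its Moore–Penrose pseudo-inverse: the extension of $(A|_{(\ker A)^\perp})^{-1}$ to $\operatorname{ran}A\oplus(\operatorname{ran}A)^\perp$ with kernel $(\operatorname{ran}A)^\perp$. - $\mathsf A(\mathcal H;\mathcal G)$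 is the set of maps $h\mapsto b+Ah$ with $b\in\mathcal G$ and $A$ bounded linear. - $\mathbb E^{\mathsf A}[U|V]$ is the $L^2(\mathbb P;\mathcal G)$-orthogonal projection of $U$ onto the $L^2$-closure of $\{\gamma\circ V:\gamma\in\mathsf A(\mathcal H;\mathcal G)\}$. *)

theory Defs
  imports "HOL-Probability.Probability"
begin

definition L2 :: "'w measure \<Rightarrow> ('w \<Rightarrow> 'g::{real_inner,banach,second_countable_topology}) \<Rightarrow> bool" where
  "L2 M X \<longleftrightarrow> X \<in> borel_measurable M \<and> integrable M (\<lambda>\<omega>. (norm (X \<omega>))\<^sup>2)"

definition bmean :: "'w measure \<Rightarrow> ('w \<Rightarrow> 'g::{real_inner,banach,second_countable_topology}) \<Rightarrow> 'g" where
  "bmean M X = integral\<^sup>L M X"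

text \<open>Cross-covariance operator C_XY = E[(X - mu_X) (x) (Y - mu_Y)] : H -> G,
  applied to h, using (g (x) h) h' = <h, h'> g.\<close>
definition cov :: "'w measure \<Rightarrow> ('w \<Rightarrow> 'g::{real_inner,banach,second_countable_topology})
     \<Rightarrow> ('w \<Rightarrow> 'h::{real_inner,banach,second_countable_topology}) \<Rightarrow> 'h \<Rightarrow> 'g" where
  "cov M X Y = (\<lambda>h'. integral\<^sup>L M (\<lambda>\<omega>. inner (Y \<omega> - bmean M Y) h' *\<^sub>R (X \<omega> - bmean M X)))"

definition orth_compl :: "'a::real_inner set \<Rightarrow> 'a set" where
  "orth_compl S = {x. \<forall>y\<in>S. inner x y = 0}"

text \<open>Moore-Penrose pseudo-inverse: defined on ran A + (ran A)^perp, with kernel (ran A)^perp,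
  inverting A restricted to (ker A)^perp.\<close>
definition pinv_dom :: "('a::real_inner \<Rightarrow> 'b::real_inner) \<Rightarrow> 'b set" where
  "pinv_dom A = {a + b |a b. a \<in> range A \<and> b \<in> orth_compl (range A)}"

definition pinv :: "('a::real_inner \<Rightarrow> 'b::real_inner) \<Rightarrow> 'b \<Rightarrow> 'a" where
  "pinv A y = (THE x. x \<in> orth_compl (A -` {0}) \<and> (\<exists>b\<in>orth_compl (range A). y = A x + b))"

definition adjoint_op :: "('a::real_inner \<Rightarrow> 'b::real_inner) \<Rightarrow> 'b \<Rightarrow> 'a" where
  "adjoint_op A = (THE B. \<forall>x y. inner (A x) y = inner x (B y))"

definition affine_maps :: "('h::real_normed_vector \<Rightarrow> 'g::real_normed_vector) set" where
  "affine_maps = {(\<lambda>h. b + A h) |b A. bounded_linear A}"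

definition mse :: "'w measure \<Rightarrow> ('w \<Rightarrow> 'g::real_normed_vector) \<Rightarrow> ('w \<Rightarrow> 'h) \<Rightarrow> ('h \<Rightarrow> 'g) \<Rightarrow> ennreal" where
  "mse M U V \<gamma> = (\<integral>\<^sup>+ \<omega>. ennreal ((norm (U \<omega> - \<gamma> (V \<omega>)))\<^sup>2) \<partial>M)"

definition affine_L2_closure :: "'w measure \<Rightarrow> ('w \<Rightarrow> 'h::{real_inner,banach,second_countable_topology})
     \<Rightarrow> ('w \<Rightarrow> 'g::{real_inner,banach,second_countable_topology}) set" where
  "affine_L2_closure M V = {W. L2 M W \<and>
     (\<forall>e>0. \<exists>\<gamma>\<in>affine_maps. (\<integral>\<^sup>+ \<omega>. ennreal ((norm (W \<omega> - \<gamma> (V \<omega>)))\<^sup>2) \<partial>M) < ennreal e)}"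

definition is_L2_proj :: "'w measure \<Rightarrow> ('w \<Rightarrow> 'g::{real_inner,banach,second_countable_topology}) set
     \<Rightarrow> ('w \<Rightarrow> 'g) \<Rightarrow> ('w \<Rightarrow> 'g) \<Rightarrow> bool" where
  "is_L2_proj M S U W \<longleftrightarrow> W \<in> S \<and> (\<forall>Z\<in>S. integral\<^sup>L M (\<lambda>\<omega>. inner (U \<omega> - W \<omega>) (Z \<omega>)) = 0)"

end

theory Submission
  imports Defs
begin

text \<open>
  Write \<open>Q = C\<^sub>V\<^sup>\<dagger> C\<^sub>V\<^sub>U\<close> and let \<open>R = U - \<gamma>(V)\<close> be the residual of the candidate
  \<open>\<gamma>(v) = \<mu>\<^sub>U + Q\<^sup>*(v - \<mu>\<^sub>V)\<close>. The graph of \<open>Q\<close> is cut out by the closed conditions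
  \<open>C\<^sub>V x = C\<^sub>V\<^sub>U g\<close> and \<open>x \<bottom> ker C\<^sub>V\<close>, so \<open>Q\<close> is bounded by the closed graph theorem. Taking
  adjoints in the normal equation \<open>C\<^sub>V Q = C\<^sub>V\<^sub>U\<close> gives \<open>Q\<^sup>* C\<^sub>V = C\<^sub>U\<^sub>V\<close>, which says that \<open>R\<close> is
  uncorrelated with \<open>V\<close>, hence with every affine image \<open>W\<close> of \<open>V\<close>. For uncorrelated \<open>R\<close> and \<open>W\<close>
  with \<open>R\<close> centred, \<open>E \<langle>R, W\<rangle> = 0\<close>: in finite dimensions this is the vanishing of a trace, and the
  general case follows by finite-rank orthogonal projections converging strongly to the identity.
  So \<open>R\<close> is orthogonal to the affine functions of \<open>V\<close> and to their closure, and Pythagoras finishes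
  the proof.
\<close>

section \<open>The closed graph theorem\<close>

lemma cball_subset_closure_sublevel:
  fixes f :: "'a::banach \<Rightarrow> 'b::real_normed_vector"
  obtains a r n where "r > 0" "cball a r \<subseteq> closure {x. norm (f x) \<le> real n}"
proof -
  define F where "F n = closure {x. norm (f x) \<le> real n}" for n
  have closed: "closed (F n)" for n by (simp add: F_def)
  have "(\<Union>n. F n) = UNIV"
  proof (intro equalityI subset_UNIV subsetI)
    fix x
    obtain n where "norm (f x) \<le> real n" using real_arch_simple by blast
    then have "x \<in> F n" unfolding F_def by (intro subsetD[OF closure_subset]) simp
    then show "x \<in> (\<Union>n. F n)" by blast
  qed
  moreover have "interior (\<Union>n. F n) = {}" if "\<And>n. interior (F n) = {}"
    using Met_TC.metric_Baire_category_alt[of "range F"] that closed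
    by (auto simp: complete_UNIV)
  ultimately obtain n a where "a \<in> interior (F n)"
    by (metis UNIV_not_empty ex_in_conv interior_UNIV)
  then obtain r where "r > 0" "cball a r \<subseteq> F n" by (auto simp: mem_interior_cball)
  then show thesis by (rule that[folded F_def])
qed

lemma linear_nearly_continuous:
  fixes f :: "'a::banach \<Rightarrow> 'b::real_normed_vector"
  assumes "linear f"
  obtains K where "K \<ge> 0" "\<And>x. x \<in> closure {y. norm (f y) \<le> K * norm x}"
proof -
  interpret linear f by fact
  obtain a r n where r: "r > 0" "cball a r \<subseteq> closure {x. norm (f x) \<le> real n}"
    by (rule cball_subset_closure_sublevel)
  show thesis
  proof (rule that[of "2 * real n / r"])
    fix x :: 'a
    \<comment> \<open>For \<open>x = 0\<close> these give \<open>w = 0\<close>, since \<open>r / 0 = 0\<close>.\<close>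
    define s where "s = norm x / r"
    define w where "w = (r / norm x) *\<^sub>R x"
    have s: "s \<ge> 0" "s *\<^sub>R w = x" using r(1) by (auto simp: s_def w_def)
    have "norm w \<le> r" using r(1) by (simp add: w_def)
    then have "a + w \<in> cball a r" "a \<in> cball a r" using r(1) by (auto simp: dist_norm)
    then obtain u v where u: "\<And>k. norm (f (u k)) \<le> n" "u \<longlonglongrightarrow> a + w"
      and v: "\<And>k. norm (f (v k)) \<le> n" "v \<longlonglongrightarrow> a"
      using r(2) unfolding closure_sequential subset_iff by (metis mem_Collect_eq)
    have "(\<lambda>k. s *\<^sub>R (u k - v k)) \<longlonglongrightarrow> s *\<^sub>R (a + w - a)"
      by (intro tendsto_intros u v)
    then have "(\<lambda>k. s *\<^sub>R (u k - v k)) \<longlonglongrightarrow> x" using s by simp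
    moreover have "norm (f (s *\<^sub>R (u k - v k))) \<le> 2 * real n / r * norm x" for k
    proof -
      have "norm (f (s *\<^sub>R (u k - v k))) = s * norm (f (u k) - f (v k))"
        using s by (simp add: scale diff)
      also have "\<dots> \<le> s * (real n + real n)"
        using u(1)[of k] v(1)[of k] s by (intro mult_left_mono norm_triangle_le_diff) auto
      also have "\<dots> = 2 * real n / r * norm x" by (simp add: s_def)
      finally show ?thesis .
    qed
    ultimately show "x \<in> closure {y. norm (f y) \<le> 2 * real n / r * norm x}"
      unfolding closure_sequential by (intro exI[of _ "\<lambda>k. s *\<^sub>R (u k - v k)"]) simp
  qed (use r in simp)
qed

lemma halving_approximation_sums:
  fixes g :: "'a::real_normed_vector \<Rightarrow> 'a"
  assumes g: "\<And>x. norm (x - g x) \<le> norm x / 2"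
  obtains r where "\<And>n. norm (r n) \<le> norm x * (1/2) ^ n" "(\<lambda>n. g (r n)) sums x"
proof
  define r where "r n = ((\<lambda>x. x - g x) ^^ n) x" for n
  have r_Suc: "r (Suc n) = r n - g (r n)" for n by (simp add: r_def)
  show r_le: "norm (r n) \<le> norm x * (1/2) ^ n" for n
  proof (induction n)
    case (Suc n)
    then show ?case using g[of "r n"] by (simp add: r_Suc)
  qed (simp add: r_def)
  have "(\<lambda>n. norm x * (1/2) ^ n) \<longlonglongrightarrow> norm x * 0"
    by (intro tendsto_intros LIMSEQ_power_zero) simp
  then have "r \<longlonglongrightarrow> 0"
    using r_le by (intro Lim_null_comparison[of r "\<lambda>n. norm x * (1/2) ^ n"]) auto
  then show "(\<lambda>n. g (r n)) sums x"
    using telescope_sums'[of r 0] by (simp add: r_Suc r_def)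
qed

theorem closed_graph_imp_bounded_linear:
  fixes f :: "'a::banach \<Rightarrow> 'b::banach"
  assumes "linear f" and graph: "closed (range (\<lambda>x. (x, f x)))"
  shows "bounded_linear f"
proof -
  interpret linear f by fact
  obtain K where K: "K \<ge> 0" "\<And>x. x \<in> closure {y. norm (f y) \<le> K * norm x}"
    using linear_nearly_continuous[OF \<open>linear f\<close>] by blast
  have "\<exists>y. norm (x - y) \<le> norm x / 2 \<and> norm (f y) \<le> K * norm x" for x
  proof (cases "x = 0")
    case False
    then have "norm x / 2 > 0" by simp
    then show ?thesis
      using K(2)[of x] unfolding closure_approachable dist_norm
      by (metis less_imp_le mem_Collect_eq norm_minus_commute)
  qed (auto intro: exI[of _ 0] simp: zero)
  then obtain g where g: "\<And>x. norm (x - g x) \<le> norm x / 2" "\<And>x. norm (f (g x)) \<le> K * norm x"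
    by metis
  have "norm (f x) \<le> norm x * (2 * K)" for x
  proof -
    obtain r where r: "\<And>n. norm (r n) \<le> norm x * (1/2) ^ n" "(\<lambda>n. g (r n)) sums x"
      using halving_approximation_sums[of g, OF g(1)] by blast
    have fg_le: "norm (f (g (r n))) \<le> K * norm x * (1/2) ^ n" for n
      using order_trans[OF g(2) mult_left_mono[OF r(1) K(1)]] by (simp add: mult.assoc)
    have geometric: "(\<lambda>n. K * norm x * (1/2) ^ n) sums (K * norm x * 2)"
      using sums_mult[OF geometric_sums[of "1/2 :: real"]] by simp
    then have "(\<lambda>n. f (g (r n))) sums (\<Sum>n. f (g (r n)))"
      using summable_comparison_test'[of _ 0, OF _ fg_le] by (simp add: sums_iff)
    with r(2) have "(\<lambda>n. (\<Sum>i<n. g (r i), f (\<Sum>i<n. g (r i)))) \<longlonglongrightarrow> (x, \<Sum>n. f (g (r n)))"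
      unfolding sums_def sum by (rule tendsto_Pair)
    then have "(x, \<Sum>n. f (g (r n))) \<in> range (\<lambda>x. (x, f x))"
      by (rule closed_sequentially[OF graph rangeI])
    then have "norm (f x) = norm (\<Sum>n. f (g (r n)))" by auto
    also have "\<dots> \<le> (\<Sum>n. K * norm x * (1/2) ^ n)"
      using fg_le geometric by (intro norm_suminf_le) (auto simp: sums_iff)
    also have "\<dots> = norm x * (2 * K)" using geometric by (simp add: sums_iff)
    finally show ?thesis .
  qed
  then show ?thesis by (intro bounded_linear_intro[of f "2 * K"] add scale)
qed

theorem Hellinger_Toeplitz:
  fixes A :: "'a::{real_inner,banach} \<Rightarrow> 'b::{real_inner,banach}"
  assumes adj: "\<And>x y. inner (A x) y = inner x (B y)"
  shows "bounded_linear A"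
proof (rule closed_graph_imp_bounded_linear)
  have A_eqI: "A x = z" if "\<And>y. inner z y = inner x (B y)" for x z
    using that vector_eq_rdot[of "A x" z] by (simp add: adj)
  show "linear A"
    by (intro linearI A_eqI) (simp_all add: inner_add_left adj)
  have "range (\<lambda>x. (x, A x)) = (\<Inter>y. {p. inner (snd p) y = inner (fst p) (B y)})"
    using A_eqI adj by force
  moreover have "closed {p. inner (snd p) y = inner (fst p) (B y)}" for y
    by (intro closed_Collect_eq continuous_intros)
  ultimately show "closed (range (\<lambda>x. (x, A x)))" by auto
qed

section \<open>Orthogonal projection and adjoints\<close>

lemma dist_midpoint_Apollonius:
  fixes x y z :: "'a::real_inner"
  shows "(dist y z)\<^sup>2 = 2 * (dist x y)\<^sup>2 + 2 * (dist x z)\<^sup>2 - 4 * (dist x (midpoint y z))\<^sup>2"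
  unfolding dist_norm power2_norm_eq_inner midpoint_def
  by (simp add: algebra_simps inner_commute)

lemma dist_almost_nearest_points_le:
  fixes S :: "'a::real_inner set"
  assumes "convex S" "y \<in> S" "z \<in> S"
    and "(dist x y)\<^sup>2 \<le> (infdist x S)\<^sup>2 + e" "(dist x z)\<^sup>2 \<le> (infdist x S)\<^sup>2 + e"
  shows "(dist y z)\<^sup>2 \<le> 4 * e"
proof -
  have "midpoint y z \<in> S"
    using assms closed_segment_subset midpoint_in_closed_segment by blast
  then have "(infdist x S)\<^sup>2 \<le> (dist x (midpoint y z))\<^sup>2"
    by (intro power_mono infdist_le infdist_nonneg)
  then show ?thesis using assms by (simp add: dist_midpoint_Apollonius[of y z x])
qed

lemma almost_nearest_point_exists:
  assumes "S \<noteq> {}" "e > 0"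
  obtains y where "y \<in> S" "(dist x y)\<^sup>2 \<le> (infdist x S)\<^sup>2 + e"
proof -
  have "infdist x S < sqrt ((infdist x S)\<^sup>2 + e)"
    using \<open>e > 0\<close> by (intro real_less_rsqrt) simp
  then obtain y where "y \<in> S" "dist x y < sqrt ((infdist x S)\<^sup>2 + e)"
    using \<open>S \<noteq> {}\<close> by (auto simp: infdist_notempty cINF_less_iff)
  then show thesis using that[of y] sqrt_ge_absD[of "dist x y"] by simp
qed

theorem convex_closed_nearest_point:
  fixes S :: "'a::{real_inner,banach} set"
  assumes "convex S" "closed S" "S \<noteq> {}"
  obtains p where "p \<in> S" "\<And>y. y \<in> S \<Longrightarrow> dist x p \<le> dist x y"
proof -
  let ?d = "infdist x S"
  define F where "F n = S \<inter> {y. (dist x y)\<^sup>2 \<le> ?d\<^sup>2 + inverse (real (Suc n))}" for n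
  obtain p where p: "\<And>n. p \<in> F n"
  proof (rule decreasing_closed_nest[of F])
    show "closed (F n)" for n
      unfolding F_def by (intro closed_Int closed_Collect_le continuous_intros \<open>closed S\<close>)
    show "F n \<noteq> {}" for n
      using almost_nearest_point_exists[OF \<open>S \<noteq> {}\<close>, of "inverse (real (Suc n))" x]
      unfolding F_def by (auto simp del: of_nat_Suc)
    show "F n \<subseteq> F m" if "m \<le> n" for m n
      using that by (auto simp: F_def elim!: order_trans)
    show "\<exists>n. \<forall>y\<in>F n. \<forall>z\<in>F n. dist y z < e" if "e > 0" for e :: real
    proof -
      have "e\<^sup>2 / 4 > 0" using that by simp
      then obtain n where n: "inverse (real (Suc n)) < e\<^sup>2 / 4"
        using reals_Archimedean by blast
      have "(dist y z)\<^sup>2 < e\<^sup>2" if "y \<in> F n" "z \<in> F n" for y z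
        using dist_almost_nearest_points_le[OF \<open>convex S\<close>, of y z x "inverse (real (Suc n))"] that n
        by (simp add: F_def)
      then show ?thesis using that by (meson less_imp_le power2_less_imp_less)
    qed
  qed (use that in blast)
  have "(\<lambda>n. ?d\<^sup>2 + inverse (real (Suc n))) \<longlonglongrightarrow> ?d\<^sup>2 + 0"
    by (intro tendsto_intros LIMSEQ_inverse_real_of_nat)
  then have "(dist x p)\<^sup>2 \<le> ?d\<^sup>2"
    using p by (auto simp: F_def intro: LIMSEQ_le_const)
  then have "dist x p \<le> ?d"
    by (rule power2_le_imp_le) (rule infdist_nonneg)
  moreover have "p \<in> S" using p by (simp add: F_def)
  ultimately show thesis using that infdist_le order_trans by blast
qed

lemma closed_subspace_projection:
  fixes S :: "'a::{real_inner,banach} set"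
  assumes "subspace S" "closed S"
  obtains p where "p \<in> S" "x - p \<in> orth_compl S"
proof -
  have "convex S" "S \<noteq> {}"
    using \<open>subspace S\<close> subspace_imp_convex subspace_0 by auto
  then obtain p where p: "p \<in> S" "\<And>y. y \<in> S \<Longrightarrow> dist x p \<le> dist x y"
    using convex_closed_nearest_point \<open>closed S\<close> by metis
  have "inner (x - p) y \<le> 0" if "y \<in> S" for y
    using any_closest_point_dot[OF \<open>convex S\<close> \<open>closed S\<close> p(1), of "p + y" x] p that
      subspace_add[OF \<open>subspace S\<close>] by simp
  from this this[OF subspace_neg[OF \<open>subspace S\<close>]] have "x - p \<in> orth_compl S"
    by (force simp: orth_compl_def intro: antisym)
  with p(1) show thesis by (rule that)
qed

lemma kernel_projection:
  fixes A :: "'a::{real_inner,banach} \<Rightarrow> 'b::real_normed_vector"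
  assumes A: "bounded_linear A"
  obtains p where "A p = 0" "x - p \<in> orth_compl (A -` {0})"
proof -
  interpret bounded_linear A by fact
  have "subspace (A -` {0})"
    by (intro linear_subspace_vimage linear_axioms subspace_single_0)
  moreover have "closed (A -` {0})"
    by (intro closed_vimage linear_continuous_on A) auto
  ultimately show thesis
    using closed_subspace_projection[of "A -` {0}" x] that by auto
qed

theorem Riesz_representation:
  fixes f :: "'a::{real_inner,banach} \<Rightarrow> real"
  assumes f: "bounded_linear f"
  obtains z where "\<And>x. f x = inner x z"
proof (cases "\<forall>x. f x = 0")
  case True
  then show thesis using that[of 0] by simp
next
  case False
  interpret bounded_linear f by fact
  obtain u where u: "f u \<noteq> 0" using False by blast
  obtain p where p: "f p = 0" "u - p \<in> orth_compl (f -` {0})"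
    using kernel_projection[OF f] by blast
  define q where "q = u - p"
  have fq: "f q \<noteq> 0" using u p by (simp add: q_def diff)
  then have qq: "inner q q \<noteq> 0" using zero by auto
  have "f x = inner x ((f q / inner q q) *\<^sub>R q)" for x
  proof -
    have "f (x - (f x / f q) *\<^sub>R q) = 0" using fq by (simp add: diff scaleR)
    then have "inner q (x - (f x / f q) *\<^sub>R q) = 0" using p by (simp add: q_def orth_compl_def)
    then have "inner q x = f x / f q * inner q q" by (simp add: inner_diff_right)
    then show ?thesis using fq qq by (simp add: inner_commute)
  qed
  then show thesis by (rule that)
qed

lemma inner_adjoint_op:
  fixes A :: "'a::{real_inner,banach} \<Rightarrow> 'b::real_inner"
  assumes "bounded_linear A"
  shows "inner (A x) y = inner x (adjoint_op A y)"
proof -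
  have "\<exists>z. \<forall>x. inner (A x) y = inner x z" for y
    using Riesz_representation[OF bounded_linear_compose[OF bounded_linear_inner_left assms]]
    by metis
  then obtain B where "\<forall>x y. inner (A x) y = inner x (B y)" by metis
  then have "\<exists>!B. \<forall>x y. inner (A x) y = inner x (B y)"
    using adjoint_unique by metis
  from theI'[OF this] show ?thesis unfolding adjoint_op_def by blast
qed

lemma bounded_linear_adjoint_op:
  fixes A :: "'a::{real_inner,banach} \<Rightarrow> 'b::{real_inner,banach}"
  assumes "bounded_linear A"
  shows "bounded_linear (adjoint_op A)"
  by (rule Hellinger_Toeplitz[of _ A]) (metis assms inner_adjoint_op inner_commute)

section \<open>Pseudo-inverses\<close>

lemma subspace_orth_compl: "subspace (orth_compl S)"
  by (auto simp: subspace_def orth_compl_def inner_add_left)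

lemma closed_orth_compl: "closed (orth_compl S)"
proof -
  have "orth_compl S = (\<Inter>y\<in>S. {x. inner x y = 0})" by (auto simp: orth_compl_def)
  then show ?thesis by (auto intro!: closed_INT closed_Collect_eq continuous_intros)
qed

lemma orth_compl_Int_eq_0: "x \<in> S \<Longrightarrow> x \<in> orth_compl S \<Longrightarrow> x = 0"
  by (simp add: orth_compl_def) (metis inner_eq_zero_iff)

lemma range_subset_pinv_dom: "range A \<subseteq> pinv_dom A"
proof
  fix y assume "y \<in> range A"
  then have "y = y + 0 \<and> y \<in> range A \<and> 0 \<in> orth_compl (range A)"
    by (simp add: subspace_0 subspace_orth_compl)
  then show "y \<in> pinv_dom A" unfolding pinv_dom_def by blast
qed

lemma pinv_eqI:
  assumes "linear A" and x: "x \<in> orth_compl (A -` {0})"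
  shows "pinv A (A x) = x"
  unfolding pinv_def
proof (rule the_equality)
  show "x \<in> orth_compl (A -` {0}) \<and> (\<exists>b\<in>orth_compl (range A). A x = A x + b)"
    using x subspace_0[OF subspace_orth_compl] by force
next
  interpret linear A by fact
  fix z assume z: "z \<in> orth_compl (A -` {0}) \<and> (\<exists>b\<in>orth_compl (range A). A x = A z + b)"
  then have "A (x - z) \<in> orth_compl (range A)" by (auto simp: diff)
  then have "A (x - z) = 0" by (rule orth_compl_Int_eq_0[OF rangeI])
  then have "x - z \<in> A -` {0}" by simp
  moreover have "x - z \<in> orth_compl (A -` {0})"
    using x z subspace_diff[OF subspace_orth_compl] by blast
  ultimately have "x - z = 0" by (rule orth_compl_Int_eq_0)
  then show "z = x" by simp
qed

lemma pinv_range: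
  fixes A :: "'a::{real_inner,banach} \<Rightarrow> 'b::real_inner"
  assumes A: "bounded_linear A" and "y \<in> range A"
  shows pinv_in_orth_compl_kernel: "pinv A y \<in> orth_compl (A -` {0})"
    and pinv_right_inverse: "A (pinv A y) = y"
proof -
  interpret bounded_linear A by fact
  obtain x where x: "y = A x" using \<open>y \<in> range A\<close> by blast
  obtain p where p: "A p = 0" "x - p \<in> orth_compl (A -` {0})"
    using kernel_projection[OF A] by blast
  moreover have "A (x - p) = y" using x p by (simp add: diff)
  ultimately have "pinv A y = x - p" using pinv_eqI[OF linear_axioms] by metis
  with p \<open>A (x - p) = y\<close> show "pinv A y \<in> orth_compl (A -` {0})" "A (pinv A y) = y" by auto
qed

theorem bounded_linear_pinv_comp:
  fixes A :: "'a::{real_inner,banach} \<Rightarrow> 'b::real_inner" and C :: "'c::banach \<Rightarrow> 'b"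
  assumes A: "bounded_linear A" and C: "bounded_linear C" and range: "range C \<subseteq> range A"
  shows "bounded_linear (\<lambda>g. pinv A (C g))"
proof (rule closed_graph_imp_bounded_linear)
  interpret A: bounded_linear A by fact
  interpret C: bounded_linear C by fact
  have "C g \<in> range A" for g using range by blast
  note pinv_C = pinv_range[OF A this]
  have pinv_C_eqI: "pinv A (C g) = x" if "x \<in> orth_compl (A -` {0})" "A x = C g" for g x
    using pinv_eqI[OF A.linear_axioms that(1)] that(2) by simp
  show "linear (\<lambda>g. pinv A (C g))"
    by (intro linearI pinv_C_eqI)
      (simp_all add: subspace_add subspace_scale subspace_orth_compl pinv_C
        A.add C.add A.scaleR C.scaleR)
  have "x = pinv A (C g) \<longleftrightarrow> A x = C g \<and> x \<in> orth_compl (A -` {0})" for g x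
    using pinv_C pinv_C_eqI by metis
  then have "range (\<lambda>g. (g, pinv A (C g))) =
      {p. A (snd p) = C (fst p)} \<inter> UNIV \<times> orth_compl (A -` {0})"
    by (auto simp: set_eq_iff image_iff)
  moreover have "closed {p. A (snd p) = C (fst p)}"
    by (intro closed_Collect_eq A.continuous_on C.continuous_on continuous_intros)
  ultimately show "closed (range (\<lambda>g. (g, pinv A (C g))))"
    by (simp add: closed_Int closed_Times closed_orth_compl)
qed

section \<open>Finite-rank approximation in separable spaces\<close>

definition proj_span :: "'a::real_inner set \<Rightarrow> 'a \<Rightarrow> 'a" where
  "proj_span C x = (\<Sum>b\<in>C. (inner x b / inner b b) *\<^sub>R b)"

lemma proj_span_in_span: "proj_span C x \<in> span C"
  unfolding proj_span_def by (intro span_sum span_scale span_base)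

lemma orthogonal_diff_proj_span:
  assumes "finite C" "pairwise orthogonal C" "y \<in> span C"
  shows "orthogonal (x - proj_span C x) y"
proof (rule orthogonal_to_span[OF \<open>y \<in> span C\<close>])
  fix c assume "c \<in> C"
  then have "inner ((inner x b / inner b b) *\<^sub>R b) c = (if b = c then inner x c else 0)"
    if "b \<in> C" for b
    using that \<open>pairwise orthogonal C\<close> by (auto simp: pairwise_def orthogonal_def)
  then have "inner (proj_span C x) c = inner x c"
    using \<open>finite C\<close> \<open>c \<in> C\<close> by (simp add: proj_span_def inner_sum_left)
  then show "orthogonal (x - proj_span C x) c" by (simp add: orthogonal_def inner_diff_left)
qed

lemma norm_diff_proj_span_Pythagorean:
  assumes "finite C" "pairwise orthogonal C" "y \<in> span C"
  shows "(norm (x - y))\<^sup>2 = (norm (x - proj_span C x))\<^sup>2 + (norm (proj_span C x - y))\<^sup>2"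
  using norm_add_Pythagorean[OF orthogonal_diff_proj_span[of C "proj_span C x - y" x]] assms
  by (simp add: span_diff proj_span_in_span)

lemma norm_proj_span_le:
  assumes "finite C" "pairwise orthogonal C"
  shows "norm (proj_span C x) \<le> norm x"
  by (rule power2_le_imp_le) (use norm_diff_proj_span_Pythagorean[OF assms span_zero, of x] in auto)

lemma norm_diff_proj_span_le:
  assumes "finite C" "pairwise orthogonal C" "y \<in> span C"
  shows "norm (x - proj_span C x) \<le> norm (x - y)"
  by (rule power2_le_imp_le) (use norm_diff_proj_span_Pythagorean[OF assms, of x] in auto)

lemma proj_span_approximates_identity:
  obtains C :: "nat \<Rightarrow> 'a::{real_inner,second_countable_topology} set"
  where "\<And>n. finite (C n)" "\<And>n. pairwise orthogonal (C n)"
    "\<And>x. (\<lambda>n. proj_span (C n) x) \<longlonglongrightarrow> x"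
proof -
  obtain D :: "'a set" where D: "countable D" "\<And>X. open X \<Longrightarrow> X \<noteq> {} \<Longrightarrow> \<exists>d\<in>D. d \<in> X"
    by (erule countable_dense_setE)
  define d where "d = from_nat_into D"
  have "\<exists>C. finite C \<and> span C = span (d ` {..n}) \<and> pairwise orthogonal C" for n
    using basis_orthogonal[of "d ` {..n}"] by auto
  then obtain C where C: "\<And>n. finite (C n)" "\<And>n. span (C n) = span (d ` {..n})"
    "\<And>n. pairwise orthogonal (C n)"
    by metis
  have "(\<lambda>n. proj_span (C n) x) \<longlonglongrightarrow> x" for x
  proof (rule metric_LIMSEQ_I)
    fix r :: real assume "r > 0"
    then obtain k where k: "dist x (d k) < r"
      using D(2)[of "ball x r"] from_nat_into_surj[OF D(1)] by (auto simp: d_def)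
    have "dist (proj_span (C n) x) x < r" if "n \<ge> k" for n
    proof -
      have "d k \<in> span (C n)" unfolding C(2) using that by (intro span_base) simp
      then have "norm (x - proj_span (C n) x) \<le> norm (x - d k)"
        by (intro norm_diff_proj_span_le C)
      then show ?thesis using k by (simp add: dist_norm norm_minus_commute)
    qed
    then show "\<exists>k. \<forall>n\<ge>k. dist (proj_span (C n) x) x < r" by blast
  qed
  with C show thesis by (intro that)
qed

section \<open>Square-integrable random vectors\<close>

lemma L2_measurable: "L2 M X \<Longrightarrow> X \<in> borel_measurable M"
  by (simp add: L2_def)

lemma L2_add:
  assumes "L2 M X" "L2 M Y"
  shows "L2 M (\<lambda>\<omega>. X \<omega> + Y \<omega>)"
proof -
  note [measurable] = assms[THEN L2_measurable]
  have "(norm (x + y))\<^sup>2 \<le> 2 * (norm x)\<^sup>2 + 2 * (norm y)\<^sup>2" for x y :: 'b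
  proof -
    have "(norm (x + y))\<^sup>2 \<le> (norm x + norm y)\<^sup>2" by (intro power_mono norm_triangle_ineq) auto
    also have "\<dots> \<le> 2 * (norm x)\<^sup>2 + 2 * (norm y)\<^sup>2"
      using sum_squares_bound[of "norm x" "norm y"] by (simp add: power2_sum)
    finally show ?thesis .
  qed
  moreover have "integrable M (\<lambda>\<omega>. 2 * (norm (X \<omega>))\<^sup>2 + 2 * (norm (Y \<omega>))\<^sup>2)"
    using assms by (auto simp: L2_def)
  ultimately have "integrable M (\<lambda>\<omega>. (norm (X \<omega> + Y \<omega>))\<^sup>2)"
    by (elim Bochner_Integration.integrable_bound) auto
  then show ?thesis by (simp add: L2_def)
qed

lemma L2_bounded_linear:
  assumes T: "bounded_linear T" and X: "L2 M X"
  shows "L2 M (\<lambda>\<omega>. T (X \<omega>))"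
proof -
  note [measurable] = X[THEN L2_measurable]
  have [measurable]: "(\<lambda>\<omega>. T (X \<omega>)) \<in> borel_measurable M"
    by (intro borel_measurable_continuous_on[of T] linear_continuous_on T) simp
  have "(norm (T x))\<^sup>2 \<le> (onorm T)\<^sup>2 * (norm x)\<^sup>2" for x
    using power_mono[OF onorm[OF T, of x], where n = 2] by (simp add: power_mult_distrib)
  moreover have "integrable M (\<lambda>\<omega>. (onorm T)\<^sup>2 * (norm (X \<omega>))\<^sup>2)"
    using X by (auto simp: L2_def)
  ultimately have "integrable M (\<lambda>\<omega>. (norm (T (X \<omega>)))\<^sup>2)"
    by (elim Bochner_Integration.integrable_bound) auto
  then show ?thesis by (simp add: L2_def)
qed

lemma L2_diff:
  assumes "L2 M X" "L2 M Y"
  shows "L2 M (\<lambda>\<omega>. X \<omega> - Y \<omega>)"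
  using L2_add[OF assms(1)
      L2_bounded_linear[OF bounded_linear_minus[OF bounded_linear_ident] assms(2)]]
  by simp

lemma (in finite_measure) L2_const: "L2 M (\<lambda>_. c)"
  by (simp add: L2_def)

lemma (in finite_measure) L2_imp_integrable:
  assumes "L2 M X"
  shows "integrable M X"
  using square_integrable_imp_integrable[of "\<lambda>\<omega>. norm (X \<omega>)"] assms
  by (auto simp: L2_def intro: integrable_norm_cancel)

lemma (in finite_measure) L2_affine:
  assumes "\<gamma> \<in> affine_maps" "L2 M V"
  shows "L2 M (\<lambda>\<omega>. \<gamma> (V \<omega>))"
proof -
  obtain b T where "\<gamma> = (\<lambda>v. b + T v)" "bounded_linear T"
    using assms(1) by (auto simp: affine_maps_def)
  with L2_add[OF L2_const L2_bounded_linear[OF _ assms(2)]] show ?thesis by simp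
qed

lemma (in finite_measure) affine_comp_in_affine_L2_closure:
  assumes "\<gamma> \<in> affine_maps" "L2 M V"
  shows "(\<lambda>\<omega>. \<gamma> (V \<omega>)) \<in> affine_L2_closure M V"
  using assms by (auto simp: affine_L2_closure_def L2_affine intro!: bexI[of _ \<gamma>])

lemma L2_integrable_bilinear:
  fixes prod :: "'a::{real_inner,banach,second_countable_topology} \<Rightarrow>
    'b::{real_inner,banach,second_countable_topology} \<Rightarrow> 'c::{banach,second_countable_topology}"
  assumes prod: "bounded_bilinear prod" and X: "L2 M X" and Y: "L2 M Y"
  shows "integrable M (\<lambda>\<omega>. prod (X \<omega>) (Y \<omega>))"
proof -
  interpret bounded_bilinear prod by fact
  note [measurable] = X[THEN L2_measurable] Y[THEN L2_measurable]
  obtain K where K: "K \<ge> 0" "\<And>x y. norm (prod x y) \<le> norm x * norm y * K"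
    using nonneg_bounded by blast
  show ?thesis
  proof (rule Bochner_Integration.integrable_bound)
    show "integrable M (\<lambda>\<omega>. ((norm (X \<omega>))\<^sup>2 + (norm (Y \<omega>))\<^sup>2) * K)"
      using X Y by (simp add: L2_def)
    show "(\<lambda>\<omega>. prod (X \<omega>) (Y \<omega>)) \<in> borel_measurable M"
      by (intro borel_measurable_continuous_Pair[of X M Y prod] continuous_on continuous_intros)
        auto
    have "norm (prod x y) \<le> ((norm x)\<^sup>2 + (norm y)\<^sup>2) * K" for x y
    proof -
      have "0 \<le> norm x * norm y" by simp
      then have "norm x * norm y \<le> (norm x)\<^sup>2 + (norm y)\<^sup>2"
        using sum_squares_bound[of "norm x" "norm y"] by linarith
      then show ?thesis using K order_trans mult_right_mono by blast
    qed
    then show "AE \<omega> in M. norm (prod (X \<omega>) (Y \<omega>)) \<le> norm (((norm (X \<omega>))\<^sup>2 + (norm (Y \<omega>))\<^sup>2) * K)"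
      using K(1) by simp
  qed
qed

lemmas L2_integrable_inner = L2_integrable_bilinear[OF bounded_bilinear_inner]

definition L2_inner :: "'w measure \<Rightarrow> ('w \<Rightarrow> 'g::real_inner) \<Rightarrow> ('w \<Rightarrow> 'g) \<Rightarrow> real" where
  "L2_inner M X Y = (\<integral>\<omega>. inner (X \<omega>) (Y \<omega>) \<partial>M)"

lemma L2_inner_commute: "L2_inner M X Y = L2_inner M Y X"
  by (simp add: L2_inner_def inner_commute)

lemma L2_inner_nonneg: "L2_inner M X X \<ge> 0"
  by (simp add: L2_inner_def)

lemma L2_inner_add_left:
  assumes "L2 M X" "L2 M Y" "L2 M Z"
  shows "L2_inner M (\<lambda>\<omega>. X \<omega> + Y \<omega>) Z = L2_inner M X Z + L2_inner M Y Z"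
  using assms by (simp add: L2_inner_def inner_add_left L2_integrable_inner)

lemma L2_inner_add_right:
  assumes "L2 M X" "L2 M Y" "L2 M Z"
  shows "L2_inner M X (\<lambda>\<omega>. Y \<omega> + Z \<omega>) = L2_inner M X Y + L2_inner M X Z"
  using assms by (simp add: L2_inner_def inner_add_right L2_integrable_inner)

lemma L2_inner_diff_right:
  assumes "L2 M X" "L2 M Y" "L2 M Z"
  shows "L2_inner M X (\<lambda>\<omega>. Y \<omega> - Z \<omega>) = L2_inner M X Y - L2_inner M X Z"
  using assms by (simp add: L2_inner_def inner_diff_right L2_integrable_inner)

lemma L2_inner_eq_0_iff_AE:
  assumes "L2 M X"
  shows "L2_inner M X X = 0 \<longleftrightarrow> (AE \<omega> in M. X \<omega> = 0)"
  unfolding L2_inner_def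
  using integral_nonneg_eq_0_iff_AE[OF L2_integrable_inner[OF assms assms]] by simp

lemma nn_integral_norm_square_eq_L2_inner:
  assumes "L2 M X"
  shows "(\<integral>\<^sup>+ \<omega>. ennreal ((norm (X \<omega>))\<^sup>2) \<partial>M) = ennreal (L2_inner M X X)"
  using assms by (simp add: L2_def L2_inner_def nn_integral_eq_integral flip: power2_norm_eq_inner)

lemma L2_inner_add_Pythagorean:
  assumes "L2 M X" "L2 M Y" "L2_inner M X Y = 0"
  shows "L2_inner M (\<lambda>\<omega>. X \<omega> + Y \<omega>) (\<lambda>\<omega>. X \<omega> + Y \<omega>) = L2_inner M X X + L2_inner M Y Y"
  using assms L2_inner_commute[of M Y X]
  by (simp add: L2_add L2_inner_add_left L2_inner_add_right)

lemma L2_inner_Cauchy_Schwarz: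
  assumes X: "L2 M X" and Y: "L2 M Y"
  shows "(L2_inner M X Y)\<^sup>2 \<le> L2_inner M X X * L2_inner M Y Y"
proof -
  note [measurable] = X[THEN L2_measurable] Y[THEN L2_measurable]
  have "ennreal \<bar>L2_inner M X Y\<bar> \<le> (\<integral>\<^sup>+ \<omega>. ennreal (norm (inner (X \<omega>) (Y \<omega>))) \<partial>M)"
    using integral_norm_bound_ennreal[OF L2_integrable_inner[OF X Y]] by (simp add: L2_inner_def)
  also have "\<dots> \<le> (\<integral>\<^sup>+ \<omega>. ennreal (norm (X \<omega>)) * ennreal (norm (Y \<omega>)) \<partial>M)"
    by (intro nn_integral_mono) (simp add: Cauchy_Schwarz_ineq2 flip: ennreal_mult)
  finally have "(ennreal \<bar>L2_inner M X Y\<bar>)\<^sup>2 \<le>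
      (\<integral>\<^sup>+ \<omega>. ennreal (norm (X \<omega>)) * ennreal (norm (Y \<omega>)) \<partial>M)\<^sup>2"
    by (rule power_mono) simp
  also have "\<dots> \<le> (\<integral>\<^sup>+ \<omega>. (ennreal (norm (X \<omega>)))\<^sup>2 \<partial>M) * (\<integral>\<^sup>+ \<omega>. (ennreal (norm (Y \<omega>)))\<^sup>2 \<partial>M)"
    by (rule Cauchy_Schwarz_nn_integral) measurable
  also have "\<dots> = ennreal (L2_inner M X X * L2_inner M Y Y)"
    using X Y
    by (simp add: ennreal_power ennreal_mult L2_inner_nonneg nn_integral_norm_square_eq_L2_inner)
  finally show ?thesis
    by (simp add: ennreal_power L2_inner_nonneg)
qed

lemma L2_inner_tendsto_dominated:
  assumes X: "L2 M X" and Y: "L2 M Y" and meas: "\<And>n. Yn n \<in> borel_measurable M"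
    and lim: "\<And>\<omega>. (\<lambda>n. Yn n \<omega>) \<longlonglongrightarrow> Y \<omega>" and bound: "\<And>n \<omega>. norm (Yn n \<omega>) \<le> norm (Y \<omega>)"
  shows "(\<lambda>n. L2_inner M X (Yn n)) \<longlonglongrightarrow> L2_inner M X Y"
  unfolding L2_inner_def
proof (rule integral_dominated_convergence)
  note [measurable] = X[THEN L2_measurable] Y[THEN L2_measurable] meas
  have "L2 M (\<lambda>\<omega>. norm (X \<omega>))" "L2 M (\<lambda>\<omega>. norm (Y \<omega>))"
    using X Y by (auto simp: L2_def)
  then show "integrable M (\<lambda>\<omega>. norm (X \<omega>) * norm (Y \<omega>))"
    by (rule L2_integrable_bilinear[OF bounded_bilinear_mult])
  show "AE \<omega> in M. norm (inner (X \<omega>) (Yn n \<omega>)) \<le> norm (X \<omega>) * norm (Y \<omega>)" for n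
  proof (rule AE_I2)
    fix \<omega>
    have "norm (inner (X \<omega>) (Yn n \<omega>)) \<le> norm (X \<omega>) * norm (Yn n \<omega>)"
      by (simp add: Cauchy_Schwarz_ineq2)
    also have "\<dots> \<le> norm (X \<omega>) * norm (Y \<omega>)" by (intro mult_left_mono bound) auto
    finally show "norm (inner (X \<omega>) (Yn n \<omega>)) \<le> norm (X \<omega>) * norm (Y \<omega>)" .
  qed
  show "AE \<omega> in M. (\<lambda>n. inner (X \<omega>) (Yn n \<omega>)) \<longlonglongrightarrow> inner (X \<omega>) (Y \<omega>)"
    by (intro AE_I2 tendsto_intros lim)
  show "(\<lambda>\<omega>. inner (X \<omega>) (Y \<omega>)) \<in> borel_measurable M"
    "(\<lambda>\<omega>. inner (X \<omega>) (Yn n \<omega>)) \<in> borel_measurable M" for n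
    by measurable
qed

lemma L2_inner_eq_0_if_coordinates_uncorrelated:
  fixes X Y :: "'w \<Rightarrow> 'g::{real_inner,banach,second_countable_topology}"
  assumes X: "L2 M X" and Y: "L2 M Y"
    and uncorr: "\<And>g. (\<integral>\<omega>. inner (X \<omega>) g * inner (Y \<omega>) g \<partial>M) = 0"
  shows "L2_inner M X Y = 0"
proof -
  note [measurable] = X[THEN L2_measurable] Y[THEN L2_measurable]
  obtain C :: "nat \<Rightarrow> 'g set" where C: "\<And>n. finite (C n)" "\<And>n. pairwise orthogonal (C n)"
    "\<And>x. (\<lambda>n. proj_span (C n) x) \<longlonglongrightarrow> x"
    by (rule proj_span_approximates_identity) blast
  have "L2_inner M X (\<lambda>\<omega>. proj_span (C n) (Y \<omega>)) = 0" for n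
  proof -
    have L2_coord: "L2 M (\<lambda>\<omega>. inner (Z \<omega>) b)" if "L2 M Z" for Z :: "'w \<Rightarrow> 'g" and b
      by (rule L2_bounded_linear[OF bounded_linear_inner_left that])
    have "L2_inner M X (\<lambda>\<omega>. proj_span (C n) (Y \<omega>)) =
        (\<integral>\<omega>. (\<Sum>b\<in>C n. inner (X \<omega>) b * inner (Y \<omega>) b / inner b b) \<partial>M)"
      by (simp add: L2_inner_def proj_span_def inner_sum_right mult.commute)
    also have "\<dots> = (\<Sum>b\<in>C n. (\<integral>\<omega>. inner (X \<omega>) b * inner (Y \<omega>) b \<partial>M) / inner b b)"
      using L2_integrable_bilinear[OF bounded_bilinear_mult L2_coord[OF X] L2_coord[OF Y]] by simp
    finally show ?thesis by (simp add: uncorr)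
  qed
  moreover have "(\<lambda>n. L2_inner M X (\<lambda>\<omega>. proj_span (C n) (Y \<omega>))) \<longlonglongrightarrow> L2_inner M X Y"
    by (intro L2_inner_tendsto_dominated X Y C norm_proj_span_le) (unfold proj_span_def, measurable)
  ultimately show ?thesis by (simp add: LIMSEQ_const_iff)
qed

section \<open>Orthogonal projections of random vectors\<close>

lemma is_L2_proj_orthogonal: "is_L2_proj M S U W \<Longrightarrow> Z \<in> S \<Longrightarrow> L2_inner M (\<lambda>\<omega>. U \<omega> - W \<omega>) Z = 0"
  by (simp add: is_L2_proj_def L2_inner_def)

lemma is_L2_proj_Pythagorean:
  assumes proj: "is_L2_proj M S U W" and U: "L2 M U" and S: "\<And>Z. Z \<in> S \<Longrightarrow> L2 M Z" and "Z \<in> S"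
  shows "L2_inner M (\<lambda>\<omega>. U \<omega> - Z \<omega>) (\<lambda>\<omega>. U \<omega> - Z \<omega>) =
    L2_inner M (\<lambda>\<omega>. U \<omega> - W \<omega>) (\<lambda>\<omega>. U \<omega> - W \<omega>) + L2_inner M (\<lambda>\<omega>. W \<omega> - Z \<omega>) (\<lambda>\<omega>. W \<omega> - Z \<omega>)"
proof -
  have "W \<in> S" using proj by (simp add: is_L2_proj_def)
  note L2 = U S[OF \<open>W \<in> S\<close>] S[OF \<open>Z \<in> S\<close>]
  have "L2_inner M (\<lambda>\<omega>. U \<omega> - W \<omega>) (\<lambda>\<omega>. W \<omega> - Z \<omega>) = 0"
    using is_L2_proj_orthogonal[OF proj] \<open>W \<in> S\<close> \<open>Z \<in> S\<close>
    by (simp add: L2_inner_diff_right L2_diff L2)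
  from L2_inner_add_Pythagorean[OF _ _ this] show ?thesis by (simp add: L2_diff L2)
qed

lemma is_L2_proj_minimizes:
  assumes proj: "is_L2_proj M S U W" and U: "L2 M U" and S: "\<And>Z. Z \<in> S \<Longrightarrow> L2 M Z" and Z: "Z \<in> S"
  shows "(\<integral>\<^sup>+ \<omega>. ennreal ((norm (U \<omega> - W \<omega>))\<^sup>2) \<partial>M) \<le> (\<integral>\<^sup>+ \<omega>. ennreal ((norm (U \<omega> - Z \<omega>))\<^sup>2) \<partial>M)"
proof -
  have "W \<in> S" using proj by (simp add: is_L2_proj_def)
  then show ?thesis
    using is_L2_proj_Pythagorean[OF proj U S Z]
    by (simp add: nn_integral_norm_square_eq_L2_inner L2_diff U S Z L2_inner_nonneg ennreal_leI)
qed

lemma is_L2_proj_unique_AE: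
  assumes W: "is_L2_proj M S U W" and W': "is_L2_proj M S U W'"
    and U: "L2 M U" and S: "\<And>Z. Z \<in> S \<Longrightarrow> L2 M Z"
  shows "AE \<omega> in M. W \<omega> = W' \<omega>"
proof -
  have mem: "W \<in> S" "W' \<in> S" using W W' by (auto simp: is_L2_proj_def)
  have "L2_inner M (\<lambda>\<omega>. W \<omega> - W' \<omega>) (\<lambda>\<omega>. W \<omega> - W' \<omega>) +
      L2_inner M (\<lambda>\<omega>. W' \<omega> - W \<omega>) (\<lambda>\<omega>. W' \<omega> - W \<omega>) = 0"
    using is_L2_proj_Pythagorean[OF W U S mem(2)] is_L2_proj_Pythagorean[OF W' U S mem(1)] by simp
  then have "L2_inner M (\<lambda>\<omega>. W \<omega> - W' \<omega>) (\<lambda>\<omega>. W \<omega> - W' \<omega>) = 0"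
    by (simp add: add_nonneg_eq_0_iff L2_inner_nonneg)
  then show ?thesis using mem by (simp add: L2_inner_eq_0_iff_AE L2_diff S)
qed

lemma (in finite_measure) L2_inner_affine_L2_closure_eq_0:
  assumes R: "L2 M R" and V: "L2 M V" and Z: "Z \<in> affine_L2_closure M V"
    and orth: "\<And>\<gamma>. \<gamma> \<in> affine_maps \<Longrightarrow> L2_inner M R (\<lambda>\<omega>. \<gamma> (V \<omega>)) = 0"
  shows "L2_inner M R Z = 0"
proof -
  have L2_Z: "L2 M Z" using Z by (simp add: affine_L2_closure_def)
  have "(L2_inner M R Z)\<^sup>2 \<le> 0 + e" if "e > 0" for e
  proof -
    define \<delta> where "\<delta> = e / (L2_inner M R R + 1)"
    have "L2_inner M R R + 1 > 0" using L2_inner_nonneg[of M R] by linarith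
    then have "\<delta> > 0" using \<open>e > 0\<close> by (simp add: \<delta>_def)
    then obtain \<gamma> where \<gamma>: "\<gamma> \<in> affine_maps"
      and close: "(\<integral>\<^sup>+ \<omega>. ennreal ((norm (Z \<omega> - \<gamma> (V \<omega>)))\<^sup>2) \<partial>M) < ennreal \<delta>"
      using Z unfolding affine_L2_closure_def by blast
    define D where "D \<omega> = Z \<omega> - \<gamma> (V \<omega>)" for \<omega>
    have L2_D: "L2 M D" unfolding D_def using L2_Z L2_affine[OF \<gamma> V] by (rule L2_diff)
    have "L2_inner M D D \<le> \<delta>"
      using close nn_integral_norm_square_eq_L2_inner[OF L2_D]
      by (simp add: D_def ennreal_less_iff L2_inner_nonneg)
    have "L2_inner M R Z = L2_inner M R D"
      unfolding D_def using orth[OF \<gamma>] by (simp add: L2_inner_diff_right R L2_Z L2_affine[OF \<gamma> V])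
    then have "(L2_inner M R Z)\<^sup>2 \<le> L2_inner M R R * L2_inner M D D"
      using L2_inner_Cauchy_Schwarz[OF R L2_D] by simp
    also have "\<dots> \<le> L2_inner M R R * \<delta>"
      using \<open>L2_inner M D D \<le> \<delta>\<close> by (intro mult_left_mono L2_inner_nonneg)
    also have "\<dots> \<le> (L2_inner M R R + 1) * \<delta>"
      using \<open>\<delta> > 0\<close> by (intro mult_right_mono) auto
    also have "\<dots> = 0 + e" using \<open>L2_inner M R R + 1 > 0\<close> by (simp add: \<delta>_def)
    finally show ?thesis .
  qed
  then have "(L2_inner M R Z)\<^sup>2 \<le> 0" by (rule field_le_epsilon)
  then show ?thesis by simp
qed

section \<open>Covariance operators\<close>

context prob_space
begin

lemma L2_centered: "L2 M X \<Longrightarrow> L2 M (\<lambda>\<omega>. X \<omega> - bmean M X)"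
  by (intro L2_diff L2_const)

lemma bmean_diff:
  assumes "L2 M X" "L2 M Y"
  shows "bmean M (\<lambda>\<omega>. X \<omega> - Y \<omega>) = bmean M X - bmean M Y"
  using assms by (simp add: bmean_def L2_imp_integrable)

lemma bmean_affine:
  assumes T: "bounded_linear T" and X: "L2 M X"
  shows "bmean M (\<lambda>\<omega>. b + T (X \<omega>)) = b + T (bmean M X)"
  using L2_imp_integrable[OF X] L2_imp_integrable[OF L2_bounded_linear[OF T X]]
  by (simp add: bmean_def integral_bounded_linear[OF T] prob_space)

lemma integrable_cov:
  assumes "L2 M X" "L2 M Y"
  shows "integrable M (\<lambda>\<omega>. inner (Y \<omega> - bmean M Y) h *\<^sub>R (X \<omega> - bmean M X))"
  using assms
  by (intro L2_integrable_bilinear[OF bounded_bilinear_scaleR] L2_centered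
      L2_bounded_linear[OF bounded_linear_inner_left])

lemma inner_cov:
  assumes "L2 M X" "L2 M Y"
  shows "inner (cov M X Y h) g =
    (\<integral>\<omega>. inner (X \<omega> - bmean M X) g * inner (Y \<omega> - bmean M Y) h \<partial>M)"
  using integral_inner_left[OF integrable_cov[OF assms, of h], of g]
  by (simp add: cov_def mult.commute)

lemma inner_cov_adjoint:
  assumes "L2 M X" "L2 M Y"
  shows "inner (cov M X Y h) g = inner h (cov M Y X g)"
  using assms by (simp add: inner_cov inner_commute[of h] mult.commute)

lemma bounded_linear_cov:
  assumes "L2 M X" "L2 M Y"
  shows "bounded_linear (cov M X Y)"
  using inner_cov_adjoint[OF assms] by (rule Hellinger_Toeplitz)

lemma cov_diff_left:
  assumes X: "L2 M X" and Y: "L2 M Y" and Z: "L2 M Z"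
  shows "cov M (\<lambda>\<omega>. X \<omega> - Y \<omega>) Z h = cov M X Z h - cov M Y Z h"
  using integrable_cov[OF X Z] integrable_cov[OF Y Z]
  by (simp add: cov_def bmean_diff[OF X Y] algebra_simps flip: Bochner_Integration.integral_diff)

lemma cov_affine_left:
  assumes T: "bounded_linear T" and X: "L2 M X" and Y: "L2 M Y"
  shows "cov M (\<lambda>\<omega>. b + T (X \<omega>)) Y h = T (cov M X Y h)"
  using integral_bounded_linear[OF T integrable_cov[OF X Y, of h]]
  by (simp add: cov_def bmean_affine[OF T X] linear_simps[OF T])

lemma L2_inner_eq_inner_bmean_if_uncorrelated:
  fixes X Y :: "'a \<Rightarrow> 'g::{real_inner,banach,second_countable_topology}"
  assumes X: "L2 M X" and Y: "L2 M Y" and uncorr: "\<And>h. cov M X Y h = 0"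
  shows "L2_inner M X Y = inner (bmean M X) (bmean M Y)"
proof -
  let ?Xc = "\<lambda>\<omega>. X \<omega> - bmean M X" and ?Yc = "\<lambda>\<omega>. Y \<omega> - bmean M Y"
  have "L2_inner M ?Xc ?Yc = 0"
    using inner_cov[OF X Y] uncorr
    by (intro L2_inner_eq_0_if_coordinates_uncorrelated L2_centered X Y) (metis inner_zero_left)
  moreover have "L2_inner M ?Xc ?Yc = L2_inner M X Y - inner (bmean M X) (bmean M Y)"
    using X Y L2_imp_integrable[OF X] L2_imp_integrable[OF Y]
    by (simp add: L2_inner_def bmean_def inner_diff_left inner_diff_right L2_integrable_inner
        prob_space)
  ultimately show ?thesis by simp
qed

lemma L2_inner_affine_eq_0_if_uncorrelated:
  fixes R :: "'a \<Rightarrow> 'g::{real_inner,banach,second_countable_topology}"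
    and V :: "'a \<Rightarrow> 'h::{real_inner,banach,second_countable_topology}"
  assumes R: "L2 M R" and V: "L2 M V" and mean: "bmean M R = 0" and uncorr: "\<And>h. cov M R V h = 0"
    and \<gamma>: "\<gamma> \<in> affine_maps"
  shows "L2_inner M R (\<lambda>\<omega>. \<gamma> (V \<omega>)) = 0"
proof -
  obtain b T where T: "bounded_linear T" and \<gamma>_eq: "\<gamma> = (\<lambda>v. b + T v)"
    using \<gamma> by (auto simp: affine_maps_def)
  have "inner (cov M V R g) h = 0" for g h
    by (simp add: inner_cov_adjoint V R uncorr)
  then have "cov M V R g = 0" for g
    by (metis inner_eq_zero_iff)
  then have "cov M (\<lambda>\<omega>. \<gamma> (V \<omega>)) R g = 0" for g
    by (simp add: \<gamma>_eq cov_affine_left[OF T V R] linear_simps[OF T])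
  then show ?thesis
    using L2_inner_eq_inner_bmean_if_uncorrelated[OF L2_affine[OF \<gamma> V] R]
    by (simp add: mean L2_inner_commute[of M R])
qed

lemma is_L2_proj_affine_if_uncorrelated:
  fixes U :: "'a \<Rightarrow> 'g::{real_inner,banach,second_countable_topology}"
    and V :: "'a \<Rightarrow> 'h::{real_inner,banach,second_countable_topology}"
  assumes U: "L2 M U" and V: "L2 M V" and \<gamma>: "\<gamma> \<in> affine_maps"
    and mean: "bmean M (\<lambda>\<omega>. U \<omega> - \<gamma> (V \<omega>)) = 0"
    and uncorr: "\<And>h. cov M (\<lambda>\<omega>. U \<omega> - \<gamma> (V \<omega>)) V h = 0"
  shows "is_L2_proj M (affine_L2_closure M V) U (\<lambda>\<omega>. \<gamma> (V \<omega>))"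
proof -
  have R: "L2 M (\<lambda>\<omega>. U \<omega> - \<gamma> (V \<omega>))" by (rule L2_diff[OF U L2_affine[OF \<gamma> V]])
  have "L2_inner M (\<lambda>\<omega>. U \<omega> - \<gamma> (V \<omega>)) Z = 0" if "Z \<in> affine_L2_closure M V" for Z
    using that L2_inner_affine_eq_0_if_uncorrelated[OF R V mean uncorr]
    by (rule L2_inner_affine_L2_closure_eq_0[OF R V])
  then show ?thesis
    using affine_comp_in_affine_L2_closure[OF \<gamma> V] by (simp add: is_L2_proj_def L2_inner_def)
qed

end

section \<open>The affine regression map\<close>

locale covariance_range_inclusion = prob_space M
  for M :: "'w measure" +
  fixes U :: "'w \<Rightarrow> 'g::{real_inner,banach,second_countable_topology}"
    and V :: "'w \<Rightarrow> 'h::{real_inner,banach,second_countable_topology}"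
  assumes L2_U: "L2 M U" and L2_V: "L2 M V"
    and range_cov_subset: "range (cov M V U) \<subseteq> range (cov M V V)"
begin

definition coeff_adj :: "'g \<Rightarrow> 'h" where
  "coeff_adj = (\<lambda>g. pinv (cov M V V) (cov M V U g))"

abbreviation coeff :: "'h \<Rightarrow> 'g" where
  "coeff \<equiv> adjoint_op coeff_adj"

definition regression_map :: "'h \<Rightarrow> 'g" where
  "regression_map = (\<lambda>v. bmean M U + coeff (v - bmean M V))"

lemma bounded_linear_coeff_adj: "bounded_linear coeff_adj"
  unfolding coeff_adj_def
  by (intro bounded_linear_pinv_comp bounded_linear_cov L2_U L2_V range_cov_subset)

lemma bounded_linear_coeff: "bounded_linear coeff"
  by (rule bounded_linear_adjoint_op[OF bounded_linear_coeff_adj])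

lemma cov_coeff_adj: "cov M V V (coeff_adj g) = cov M V U g"
  unfolding coeff_adj_def using range_cov_subset
  by (intro pinv_right_inverse bounded_linear_cov L2_V) blast

lemma coeff_cov: "coeff (cov M V V h) = cov M U V h"
proof -
  have "inner g (coeff (cov M V V h)) = inner g (cov M U V h)" for g
  proof -
    have "inner g (coeff (cov M V V h)) = inner (coeff_adj g) (cov M V V h)"
      by (simp add: inner_adjoint_op bounded_linear_coeff_adj)
    also have "\<dots> = inner (cov M V V (coeff_adj g)) h" by (simp add: inner_cov_adjoint L2_V)
    also have "\<dots> = inner g (cov M U V h)" by (simp add: cov_coeff_adj inner_cov_adjoint L2_U L2_V)
    finally show ?thesis .
  qed
  then show ?thesis using vector_eq_ldot by blast
qed

lemma regression_map_eq:
  "regression_map v = (bmean M U - coeff (bmean M V)) + coeff v"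
  by (simp add: regression_map_def linear_simps[OF bounded_linear_coeff])

lemma regression_map_in_affine_maps: "regression_map \<in> affine_maps"
  using regression_map_eq bounded_linear_coeff unfolding affine_maps_def by blast

theorem is_L2_proj_regression_map:
  "is_L2_proj M (affine_L2_closure M V) U (\<lambda>\<omega>. regression_map (V \<omega>))"
proof (rule is_L2_proj_affine_if_uncorrelated[OF L2_U L2_V regression_map_in_affine_maps])
  note L2 = L2_U L2_V L2_affine[OF regression_map_in_affine_maps L2_V]
  show "bmean M (\<lambda>\<omega>. U \<omega> - regression_map (V \<omega>)) = 0"
    by (simp add: bmean_diff L2) (simp add: regression_map_eq bmean_affine bounded_linear_coeff L2)
  show "cov M (\<lambda>\<omega>. U \<omega> - regression_map (V \<omega>)) V h = 0" for h
    by (simp add: cov_diff_left L2)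
      (simp add: regression_map_eq cov_affine_left bounded_linear_coeff L2 coeff_cov)
qed

end

theorem mainTheorem8:
  fixes M :: "'w measure"
    and U :: "'w \<Rightarrow> 'g::{real_inner,banach,second_countable_topology}"
    and V :: "'w \<Rightarrow> 'h::{real_inner,banach,second_countable_topology}"
  assumes "prob_space M"
    and "L2 M U" and "L2 M V"
    and "range (cov M V U) \<subseteq> range (cov M V V)"
  shows "(\<forall>g. cov M V U g \<in> pinv_dom (cov M V V))
     \<and> bounded_linear (\<lambda>g. pinv (cov M V V) (cov M V U g))
     \<and> (let \<gamma>A = (\<lambda>v. bmean M U + adjoint_op (\<lambda>g. pinv (cov M V V) (cov M V U g)) (v - bmean M V))
        in \<gamma>A \<in> affine_maps
           \<and> (\<forall>\<gamma>\<in>affine_maps. mse M U V \<gamma>A \<le> mse M U V \<gamma>)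
           \<and> is_L2_proj M (affine_L2_closure M V) U (\<lambda>\<omega>. \<gamma>A (V \<omega>))
           \<and> (\<forall>W. is_L2_proj M (affine_L2_closure M V) U W \<longrightarrow> (AE \<omega> in M. W \<omega> = \<gamma>A (V \<omega>))))"
proof -
  interpret covariance_range_inclusion M U V
    using assms by (simp add: covariance_range_inclusion_def covariance_range_inclusion_axioms_def)
  have L2_closure: "L2 M Z" if "Z \<in> affine_L2_closure M V" for Z :: "'w \<Rightarrow> 'g"
    using that by (simp add: affine_L2_closure_def)
  have "cov M V U g \<in> pinv_dom (cov M V V)" for g
    using range_cov_subset range_subset_pinv_dom by blast
  moreover have "mse M U V regression_map \<le> mse M U V \<gamma>" if "\<gamma> \<in> affine_maps" for \<gamma>
    unfolding mse_def
    using is_L2_proj_regression_map L2_U L2_closure affine_comp_in_affine_L2_closure[OF that L2_V]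
    by (rule is_L2_proj_minimizes)
  moreover have "AE \<omega> in M. W \<omega> = regression_map (V \<omega>)"
    if "is_L2_proj M (affine_L2_closure M V) U W" for W
    using that is_L2_proj_regression_map L2_U L2_closure by (rule is_L2_proj_unique_AE)
  ultimately show ?thesis
    unfolding Let_def coeff_adj_def[symmetric] regression_map_def[symmetric]
    using bounded_linear_coeff_adj regression_map_in_affine_maps is_L2_proj_regression_map by blast
qed

end
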